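(* Let $k$ be a positive integer and let $f_n:[0,+\infty)\to(0,+\infty)$, $n=0,1,2,\dots$, be continuous, bounded, positive functions with $f_{n+k}=f_n$ for all $n$. Assume that for every $n=1,2,\dots,k$ the function $f_n$ is strictly decreasing on $[0,+\infty)$. If $$\prod_{n=1}^{k}f_n(0)\le 1,$$ then, for any solution $x_n$ of $$x_{n+1}=x_nf_n(x_{n-1}),\quad n=0,1,2,\dots,$$ it holds that $\lim_{n\to+\infty}x_n=0$.
   Context: A solution of $x_{n+1}=x_nf_n(x_{n-1})$, $n=0,1,2,\dots$, means a sequence $(x_n)_{n\ge -1}$ satisfying the equation with initial conditions $x_0=x^0>0$ and $x_{-1}=x^{-1}\ge 0$. *)

theory Defs
  imports "HOL-Analysis.Analysis"
begin

text \<open>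
  A sequence \<open>(x\<^sub>n)\<close> with \<open>n \<ge> -1\<close> is represented by a function on the integers; its values at
  indices below \<open>-1\<close> are unconstrained and play no role.
\<close>

definition is_solution :: "(nat \<Rightarrow> real \<Rightarrow> real) \<Rightarrow> (int \<Rightarrow> real) \<Rightarrow> bool" where
  "is_solution f x \<longleftrightarrow>
     x 0 > 0 \<and> x (-1) \<ge> 0 \<and>
     (\<forall>n::nat. x (int n + 1) = x (int n) * f n (x (int n - 1)))"

end

theory Submission
  imports Defs
begin

text \<open>
  Multiplying the equation over one period gives \<open>x\<^sub>n\<^sub>+\<^sub>k = x\<^sub>n \<Prod> f\<^sub>i(x\<^sub>i\<^sub>-\<^sub>1)\<close>, where \<open>i\<close> runs over a
  complete period. Since each \<open>f\<^sub>i\<close> is decreasing, the product is at most \<open>\<Prod> f\<^sub>i(0) \<le> 1\<close>, so \<open>x\<close>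
  decreases along every residue class modulo \<open>k\<close> and converges there
  (\<open>convergent_along_residue_class\<close>). By continuity the limits form a \<open>k\<close>-periodic nonnegative
  solution of the same equation. Such a solution vanishes (\<open>periodic_solution_eq_0\<close>): if one of
  its values were positive, all later ones would be, and then the product over a period would be
  strictly below \<open>\<Prod> f\<^sub>i(0) \<le> 1\<close>, so that the solution could not return to its value after \<open>k\<close> steps.

  The lemmas use the equation in the form \<open>z\<^sub>n\<^sub>+\<^sub>2 = z\<^sub>n\<^sub>+\<^sub>1 g\<^sub>n(z\<^sub>n)\<close>, which arises from
  \<open>z\<^sub>n = x\<^sub>n\<close> and \<open>g\<^sub>n = f\<^sub>n\<^sub>+\<^sub>1\<close>. Starting at \<open>x\<^sub>0\<close> makes all terms positive, and the shift turns
  the indices \<open>1, \<dots>, k\<close> into \<open>0, \<dots>, k - 1\<close>, the residues modulo \<open>k\<close>.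
\<close>

lemma prod_over_period:
  fixes c :: "nat \<Rightarrow> 'a::comm_monoid_mult"
  assumes "\<And>n. c (n + k) = c n"
  shows "(\<Prod>i<k. c (n + i)) = (\<Prod>i<k. c i)"
proof (induction n)
  case (Suc n)
  show ?case
  proof (cases k)
    case k: (Suc j)
    have "(\<Prod>i<k. c (Suc n + i)) = (\<Prod>i<j. c (Suc (n + i))) * c (n + k)"
      by (simp add: k)
    also have "\<dots> = c n * (\<Prod>i<j. c (Suc (n + i)))"
      by (simp add: assms mult.commute)
    also have "\<dots> = (\<Prod>i<k. c (n + i))"
      by (simp add: k prod.lessThan_Suc_shift del: prod.lessThan_Suc)
    finally show ?thesis using Suc.IH by simp
  qed simp
qed simp

lemma solution_after_period:
  fixes z :: "nat \<Rightarrow> real"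
  assumes "\<And>n. z (Suc (Suc n)) = z (Suc n) * g n (z n)"
  shows "z (Suc n + m) = z (Suc n) * (\<Prod>i<m. g (n + i) (z (n + i)))"
  using assms by (induction m) (simp_all add: mult.assoc)

text \<open>
  A nonzero periodic solution is eventually positive, hence it strictly shrinks over a period:
  every factor \<open>g n (L n)\<close> is then strictly below \<open>g n 0\<close>.
\<close>

lemma periodic_solution_eq_0:
  fixes L :: "nat \<Rightarrow> real"
  assumes "k > 0"
    and pos: "\<And>n x. x \<ge> 0 \<Longrightarrow> g n x > 0"
    and decr: "\<And>n x. x > 0 \<Longrightarrow> g n x < g n 0"
    and prod: "\<And>n. (\<Prod>i<k. g (n + i) 0) \<le> 1"
    and L: "\<And>n. L (Suc (Suc n)) = L (Suc n) * g n (L n)"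
    and nonneg: "\<And>n. L n \<ge> 0"
    and period: "\<And>n. L (n + k) = L n"
  shows "L n = 0"
proof (rule ccontr)
  assume "L n \<noteq> 0"
  \<comment> \<open>Positivity propagates only from an index of the form \<open>Suc _\<close>, so move on by one period.\<close>
  then have start: "L (n + k) > 0"
    using nonneg[of n] period[of n] by simp
  have Lpos: "L (n + k + i) > 0" for i
  proof (induction i)
    case (Suc i)
    obtain m where "n + k + i = Suc m"
      using \<open>k > 0\<close> by (cases "n + k + i") auto
    then show ?case
      using L[of m] Suc pos[OF nonneg[of m], of m] by simp
  qed (use start in simp)
  let ?N = "n + k"
  have "(\<Prod>i<k. g (?N + i) (L (?N + i))) < (\<Prod>i<k. g (?N + i) 0)"
    using \<open>k > 0\<close> Lpos start
    by (intro prod_mono_strict[of 0])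
      (auto intro!: decr less_imp_le[OF decr] less_imp_le[OF pos] pos nonneg)
  also have "\<dots> \<le> 1"
    by (rule prod)
  finally have "L (Suc ?N) * (\<Prod>i<k. g (?N + i) (L (?N + i))) < L (Suc ?N)"
    using Lpos[of 1] by simp
  then show False
    using solution_after_period[of L g ?N k, OF L] period[of "Suc ?N"] by simp
qed

text \<open>
  Over one period the factors multiply to at most \<open>1\<close>, so the sequence is decreasing and bounded
  below by \<open>0\<close> along each residue class. The assumption on the products ranges over all
  starting points \<open>n\<close>, because the telescoped product for \<open>z (Suc n)\<close> starts at the index \<open>n\<close>.
\<close>

lemma convergent_along_residue_class:
  fixes z :: "nat \<Rightarrow> real"
  assumes pos: "\<And>n x. x \<ge> 0 \<Longrightarrow> g n x > 0"
    and decr: "\<And>n x. x > 0 \<Longrightarrow> g n x < g n 0"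
    and prod: "\<And>n. (\<Prod>i<k. g (n + i) 0) \<le> 1"
    and z: "\<And>n. z (Suc (Suc n)) = z (Suc n) * g n (z n)"
    and zpos: "\<And>n. z n > 0"
  shows "convergent (\<lambda>m. z (n + m * k))"
proof -
  have step: "z (Suc n + k) \<le> z (Suc n)" for n
  proof -
    have "(\<Prod>i<k. g (n + i) (z (n + i))) \<le> (\<Prod>i<k. g (n + i) 0)"
      by (intro prod_mono) (auto intro!: less_imp_le decr pos zpos)
    also have "\<dots> \<le> 1"
      by (rule prod)
    finally show ?thesis
      unfolding solution_after_period[of z g n k, OF z]
      using zpos[of "Suc n"] by (simp add: mult_left_le)
  qed
  \<comment> \<open>Monotonicity may fail at index \<open>0\<close>, whose predecessor is outside the sequence; a shift by
    one full period avoids it.\<close>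
  show ?thesis
  proof (cases "k = 0")
    case False
    have "decseq (\<lambda>m. z (n + Suc m * k))"
    proof (rule decseq_SucI)
      fix m
      obtain j where "n + Suc m * k = Suc j"
        using False by (cases "n + Suc m * k") auto
      then show "z (n + Suc (Suc m) * k) \<le> z (n + Suc m * k)"
        using step[of j] by (simp add: algebra_simps)
    qed
    then have "convergent (\<lambda>m. z (n + Suc m * k))"
      using decseq_bounded[of _ 0] zpos
      by (blast intro: Bseq_monoseq_convergent decseq_imp_monoseq less_imp_le)
    then show ?thesis
      using convergent_Suc_iff[of "\<lambda>m. z (n + m * k)"] by simp
  qed (simp add: convergent_const)
qed

lemma LIMSEQ_from_residue_classes:
  fixes z :: "nat \<Rightarrow> 'a::topological_space"
  assumes "k > 0" and lim: "\<And>r. r < k \<Longrightarrow> (\<lambda>m. z (r + m * k)) \<longlonglongrightarrow> l"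
  shows "z \<longlonglongrightarrow> l"
proof (rule topological_tendstoI)
  fix S assume S: "open S" "l \<in> S"
  have "\<forall>\<^sub>F m in sequentially. \<forall>r\<in>{..<k}. z (r + m * k) \<in> S"
    using topological_tendstoD[OF lim S] by (simp add: eventually_ball_finite)
  then obtain M where M: "\<And>m r. m \<ge> M \<Longrightarrow> r < k \<Longrightarrow> z (r + m * k) \<in> S"
    by (auto simp: eventually_sequentially)
  have "z n \<in> S" if "n \<ge> M * k" for n
    using M[of "n div k" "n mod k"] that \<open>k > 0\<close>
    by (simp add: less_eq_div_iff_mult_less_eq)
  then show "\<forall>\<^sub>F n in sequentially. z n \<in> S"
    by (auto simp: eventually_sequentially)
qed

text \<open>
  The limits along the residue classes inherit the recurrence: along \<open>n + m * k\<close> the coefficient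
  function is always \<open>g n\<close>, so continuity at the limit lets the equation pass to it. The limits are
  indexed by all \<open>n\<close> rather than by residues, which makes their periodicity and the recurrence
  uniform in \<open>n\<close>.
\<close>

lemma positive_solution_tendsto_0:
  fixes z :: "nat \<Rightarrow> real"
  assumes "k > 0"
    and cont: "\<And>n. continuous_on {0..} (g n)"
    and pos: "\<And>n x. x \<ge> 0 \<Longrightarrow> g n x > 0"
    and decr: "\<And>n x. x > 0 \<Longrightarrow> g n x < g n 0"
    and gperiod: "\<And>n x. x \<ge> 0 \<Longrightarrow> g (n + k) x = g n x"
    and prod: "(\<Prod>i<k. g i 0) \<le> 1"
    and z: "\<And>n. z (Suc (Suc n)) = z (Suc n) * g n (z n)"
    and zpos: "\<And>n. z n > 0"
  shows "z \<longlonglongrightarrow> 0"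
proof -
  have prod': "(\<Prod>i<k. g (n + i) 0) \<le> 1" for n
    using prod_over_period[of "\<lambda>i. g i 0" k n] gperiod[of 0] prod by simp
  have gperiod': "g (n + m * k) x = g n x" if "x \<ge> 0" for n m x
  proof (induction m)
    case (Suc m)
    then show ?case
      using gperiod[OF that, of "n + m * k"] by (simp add: algebra_simps)
  qed simp
  define L where "L n = lim (\<lambda>m. z (n + m * k))" for n
  have lim: "(\<lambda>m. z (n + m * k)) \<longlonglongrightarrow> L n" for n
    using convergent_along_residue_class[of g k z n, OF pos decr prod' z zpos]
    unfolding L_def by (simp add: convergent_LIMSEQ_iff)
  have Lnonneg: "L n \<ge> 0" for n
    by (rule LIMSEQ_le_const[OF lim]) (use zpos less_imp_le in blast)
  have Lperiod: "L (n + k) = L n" for n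
  proof -
    have "(\<lambda>m. z (n + Suc m * k)) \<longlonglongrightarrow> L n"
      using LIMSEQ_Suc[OF lim] .
    then have "(\<lambda>m. z (n + k + m * k)) \<longlonglongrightarrow> L n"
      by (simp add: algebra_simps)
    then show ?thesis
      using LIMSEQ_unique lim by blast
  qed
  have Lsol: "L (Suc (Suc n)) = L (Suc n) * g n (L n)" for n
  proof -
    have "(\<lambda>m. g n (z (n + m * k))) \<longlonglongrightarrow> g n (L n)"
      using cont[of n] lim[of n]
      by (rule continuous_on_tendsto_compose)
        (use zpos Lnonneg less_imp_le in \<open>auto intro!: always_eventually\<close>)
    with lim[of "Suc n"]
    have "(\<lambda>m. z (Suc n + m * k) * g n (z (n + m * k))) \<longlonglongrightarrow> L (Suc n) * g n (L n)"
      by (rule tendsto_mult)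
    moreover have "z (Suc n + m * k) * g n (z (n + m * k)) = z (Suc (Suc n) + m * k)" for m
      using z[of "n + m * k"] gperiod'[of "z (n + m * k)" n m] zpos[of "n + m * k"] by simp
    ultimately show ?thesis
      using LIMSEQ_unique lim[of "Suc (Suc n)"] by simp
  qed
  have "L n = 0" for n
    using periodic_solution_eq_0[of k g L n, OF \<open>k > 0\<close> pos decr prod' Lsol Lnonneg Lperiod] .
  then show ?thesis
    using LIMSEQ_from_residue_classes[OF \<open>k > 0\<close>] lim by metis
qed

theorem theorem2p1:
  fixes k :: nat and f :: "nat \<Rightarrow> real \<Rightarrow> real"
  assumes "k > 0"
    and "\<And>n. continuous_on {0..} (f n)"
    and "\<And>n. bounded (f n ` {0..})"
    and "\<And>n x. x \<ge> 0 \<Longrightarrow> f n x > 0"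
    and "\<And>n x. x \<ge> 0 \<Longrightarrow> f (n + k) x = f n x"
    and "\<And>n. n \<in> {1..k} \<Longrightarrow> strict_antimono_on {0..} (f n)"
    and "(\<Prod>n = 1..k. f n 0) \<le> 1"
  shows "\<forall>x. is_solution f x \<longrightarrow> (x \<longlongrightarrow> 0) at_top"
proof (intro allI impI)
  fix x assume "is_solution f x"
  then have x0: "x 0 > 0" and xm1: "x (-1) \<ge> 0"
    and x: "\<And>n. x (int n + 1) = x (int n) * f n (x (int n - 1))"
    by (auto simp: is_solution_def)
  \<comment> \<open>The second conjunct keeps the argument of \<open>f n\<close> in its domain, also for \<open>n = 0\<close>.\<close>
  have xpos: "x (int n) > 0 \<and> x (int n - 1) \<ge> 0" for n
  proof (induction n)
    case (Suc n)
    then show ?case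
      using x[of n] assms(4)[of "x (int n - 1)" n] by (simp add: add.commute)
  qed (use x0 xm1 in simp)
  \<comment> \<open>Strict monotonicity is known for one period of indices; periodicity spreads it to the rest.\<close>
  have decr: "f (Suc n) t < f (Suc n) 0" if "t > 0" for n t
  proof (induction n rule: less_induct)
    case (less n)
    show ?case
    proof (cases "n < k")
      case True
      then show ?thesis
        using assms(6)[of "Suc n"] that by (auto simp: monotone_on_def)
    next
      case False
      then show ?thesis
        using less[of "n - k"] assms(5)[of t "Suc (n - k)"] assms(5)[of 0 "Suc (n - k)"]
          that \<open>k > 0\<close> by simp
    qed
  qed
  have "(\<Prod>n<k. f (Suc n) 0) \<le> 1"
    using assms(7) by (simp add: prod.atLeast1_atMost_eq)
  moreover have "x (int (Suc (Suc n))) = x (int (Suc n)) * f (Suc n) (x (int n))" for n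
    using x[of "Suc n"] by (simp add: add.commute)
  ultimately have "(\<lambda>n. x (int n)) \<longlonglongrightarrow> 0"
    using assms(5) xpos
    by (intro positive_solution_tendsto_0[of k "\<lambda>n. f (Suc n)"] \<open>k > 0\<close> assms(2,4) decr)
      (auto simp flip: add_Suc)
  then have "((\<lambda>i. x (int (nat i))) \<longlongrightarrow> 0) at_top"
    by (rule filterlim_compose) (rule filterlim_nat_sequentially)
  moreover have "\<forall>\<^sub>F i in at_top. x (int (nat i)) = x i"
    using eventually_ge_at_top[of 0] by eventually_elim simp
  ultimately show "(x \<longlongrightarrow> 0) at_top"
    by (rule Lim_transform_eventually)
qed

end
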